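(* Let $\mathcal{P}\subset\mathbb{Z}^2$ be an inseparable $n$-set, $n\in\mathbb{N}$, and let $\mathcal{Q}_1,\mathcal{Q}_2,\mathcal{Q}_3,\mathcal{Q}_4$ be the four quadrants, with integer diagonals $\Upsilon_{r,k}\subset\mathcal{Q}_r$ ($1\le r\le 4$, $k\in\mathbb{N}$), determined by the quartering of $\mathcal{P}$. Then for each $r\in\{1,2,3,4\}$ there exist $N_r\in\mathbb{N}$ and integers $$1\le v_{r,1}<v_{r,2}<\cdots<v_{r,N_r}$$ such that $$\mathcal{P}=\bigcup_{r=1}^{4}\ \bigcup_{t=1}^{N_r}\Upsilon_{r,v_{r,t}};$$ that is, the integer diagonals with numbers $v_{r,t}$ in the quadrant $\mathcal{Q}_r$ fully belong to $\mathcal{P}$, and these exhaust all points of $\mathcal{P}$. Moreover, $$n=\sum_{r=1}^{4}Y_r,\qquad\text{where } Y_r=\sum_{t=1}^{N_r}v_{r,t}.$$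
   Context: $\mathbb{N}$ denotes the positive integers. An uphill lattice path is the union in $\mathbb{R}^2$ of a doubly infinite sequence of unit segments $p_i\to p_{i+1}$ ($i\in\mathbb{Z}$, $p_i\in\mathbb{Z}^2$) with $p_{i+1}-p_i\in\{(1,0),(0,1)\}$ for all $i$. A downhill lattice path is defined in the same way with $p_{i+1}-p_i\in\{(1,0),(0,-1)\}$ for all $i$. A monotone lattice path is an uphill or a downhill lattice path. The complement of a monotone path in $\mathbb{R}^2$ has two sides. Given a finite set $\mathcal{P}\subset\mathbb{Z}^2$, a friendly path for $\mathcal{P}$ is a monotone lattice path such that the numbers of points of $\mathcal{P}$ lying strictly on its two sides are equal (points on the path are not counted). An inseparable $n$-set is a set $\mathcal{P}\subset\mathbb{Z}^2$ with $|\mathcal{P}|=n$ that admits no friendly path. Quartering. For a directed monotone path $\mathscr{A}$, its balance is $d(\mathscr{A})=\ell(\mathscr{A})-r(\mathscr{A})$, where $\ell(\mathscr{A})$ and $r(\mathscr{A})$ are the numbers of points of $\mathcal{P}$ strictly to the left and strictly to the right of $\mathscr{A}$. Horizontal lines $[y=K]$ are directed from left to right (so the left side is above) and vertical lines $[x=K]$ are directed upwards. For an inseparable set $\mathcal{P}$ there are unique integers $M,T$ with $$d([y=M+1])<0,\quad d([y=M])>0,\quad d([x=T])<0,\quad d([x=T+1])>0 .$$ The lines $y=M+\tfrac12$ and $x=T+\tfrac12$ divide $\mathbb{Z}^2$ into four quadrants: $\mathcal{Q}_1$ (top-right), $\mathcal{Q}_2$ (top-left), $\mathcal{Q}_3$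 (bottom-left), $\mathcal{Q}_4$ (bottom-right). In each quadrant lattice points get local coordinates $(x,y)\in\mathbb{N}^2$ measured away from the two lines: $(x,y)$ denotes the point $(T+x,M+y)$ in $\mathcal{Q}_1$, $(T+1-x,M+y)$ in $\mathcal{Q}_2$, $(T+1-x,M+1-y)$ in $\mathcal{Q}_3$, and $(T+x,M+1-y)$ in $\mathcal{Q}_4$. For $k\in\mathbb{N}$, the integer diagonal with number $k$ in $\mathcal{Q}_r$, denoted $\Upsilon_{r,k}$, is the set of the $k$ points of $\mathcal{Q}_r$ with local coordinates $(x,k+1-x)$, $1\le x\le k$. *)

theory Defs
  imports "HOL-Analysis.Analysis"
begin

definition real_pt :: "int \<times> int \<Rightarrow> real \<times> real" where
  "real_pt q = (real_of_int (fst q), real_of_int (snd q))"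

subsection \<open>Monotone lattice paths and their sides\<close>

definition uphill :: "(int \<Rightarrow> int \<times> int) \<Rightarrow> bool" where
  "uphill p \<longleftrightarrow> (\<forall>i. p (i + 1) - p i \<in> {(1, 0), (0, 1)})"

definition downhill :: "(int \<Rightarrow> int \<times> int) \<Rightarrow> bool" where
  "downhill p \<longleftrightarrow> (\<forall>i. p (i + 1) - p i \<in> {(1, 0), (0, -1)})"

definition path_trace :: "(int \<Rightarrow> int \<times> int) \<Rightarrow> (real \<times> real) set" where
  "path_trace p = (\<Union>i. closed_segment (real_pt (p i)) (real_pt (p (i + 1))))"

definition monotone_lattice_path :: "(real \<times> real) set \<Rightarrow> bool" where
  "monotone_lattice_path A \<longleftrightarrow> (\<exists>p. (uphill p \<or> downhill p) \<and> A = path_trace p)"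

text \<open>The two sides of a path are the connected components of its complement.\<close>

definition friendly_path :: "(int \<times> int) set \<Rightarrow> (real \<times> real) set \<Rightarrow> bool" where
  "friendly_path P A \<longleftrightarrow>
     monotone_lattice_path A \<and>
     (\<exists>U V. U \<noteq> V \<and> components (- A) = {U, V} \<and>
            card {q \<in> P. real_pt q \<in> U} = card {q \<in> P. real_pt q \<in> V})"

definition inseparable_set :: "nat \<Rightarrow> (int \<times> int) set \<Rightarrow> bool" where
  "inseparable_set n P \<longleftrightarrow> finite P \<and> card P = n \<and> \<not> (\<exists>A. friendly_path P A)"

text \<open>
  A directed path is given by its vertex sequence. If c is the midpoint of the step from p 0 to
  p 1 and w is this step rotated by a right angle counterclockwise, then c + w/2 and c - w/2
  are the centres of the two unit cells bordering the step; being off the lattice lines, they lie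
  in the complement, immediately to the left and to the right of the path. For a monotone path,
  the components containing them do not depend on which step is used.
\<close>

definition cell_left :: "int \<times> int \<Rightarrow> int \<times> int \<Rightarrow> real \<times> real" where
  "cell_left a b =
     midpoint (real_pt a) (real_pt b) + (1/2) *\<^sub>R real_pt (- snd (b - a), fst (b - a))"

definition cell_right :: "int \<times> int \<Rightarrow> int \<times> int \<Rightarrow> real \<times> real" where
  "cell_right a b =
     midpoint (real_pt a) (real_pt b) - (1/2) *\<^sub>R real_pt (- snd (b - a), fst (b - a))"

definition left_side :: "(int \<Rightarrow> int \<times> int) \<Rightarrow> (real \<times> real) set" where
  "left_side p = connected_component_set (- path_trace p) (cell_left (p 0) (p 1))"

definition right_side :: "(int \<Rightarrow> int \<times> int) \<Rightarrow> (real \<times> real) set" where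
  "right_side p = connected_component_set (- path_trace p) (cell_right (p 0) (p 1))"

definition balance :: "(int \<times> int) set \<Rightarrow> (int \<Rightarrow> int \<times> int) \<Rightarrow> int" where
  "balance P p = int (card {q \<in> P. real_pt q \<in> left_side p})
               - int (card {q \<in> P. real_pt q \<in> right_side p})"

subsection \<open>Quartering\<close>

definition hline :: "int \<Rightarrow> int \<Rightarrow> int \<times> int" where
  "hline K = (\<lambda>i. (i, K))"

definition vline :: "int \<Rightarrow> int \<Rightarrow> int \<times> int" where
  "vline K = (\<lambda>i. (K, i))"

text \<open>For nonempty inseparable P each of the two integers below exists and is unique.\<close>

definition quarter_M :: "(int \<times> int) set \<Rightarrow> int" where
  "quarter_M P = (THE M. balance P (hline (M + 1)) < 0 \<and> balance P (hline M) > 0)"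

definition quarter_T :: "(int \<times> int) set \<Rightarrow> int" where
  "quarter_T P = (THE T. balance P (vline T) < 0 \<and> balance P (vline (T + 1)) > 0)"

text \<open>
  The point with local coordinates (x, y), where x and y are positive, in the quadrant with
  number r in {1, 2, 3, 4}.
\<close>

definition quadrant_point :: "(int \<times> int) set \<Rightarrow> nat \<Rightarrow> int \<Rightarrow> int \<Rightarrow> int \<times> int" where
  "quadrant_point P r x y =
     (let M = quarter_M P; T = quarter_T P in
      if r = 1 then (T + x, M + y)
      else if r = 2 then (T + 1 - x, M + y)
      else if r = 3 then (T + 1 - x, M + 1 - y)
      else (T + x, M + 1 - y))"

definition int_diagonal :: "(int \<times> int) set \<Rightarrow> nat \<Rightarrow> nat \<Rightarrow> (int \<times> int) set" where
  "int_diagonal P r k = {quadrant_point P r x (int k + 1 - x) | x. 1 \<le> x \<and> x \<le> int k}"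

end

(*
  An uphill path is encoded by its height h i in the antidiagonal x + y = i. A path of balance > 0
  is turned into one of balance < 0 lying above it by flipping one corner at a time; a flip changes
  the balance by at most 2, so without friendly paths some flip goes from 1 to -1, and both points
  exchanged by it belong to P. For two neighbouring points (x + 1, y), (x, y + 1) on a diagonal of
  the first quadrant, such a sweep exists among the paths passing through (x, y + 1) and both
  (x, y), (x + 1, y + 1). At the path of balance -1 one flips at (x, y + 1) instead: if exactly one
  of the two points were in P, the new balance would be 0. The other quadrants and the downhill
  paths follow by reflection.
*)

theory Submission
  imports Defs
begin

section \<open>Height functions and their balance\<close>

text \<open>
  A height function h stands for the uphill path with vertices (i - h i, h i). A lattice point q
  lies to its left, on it, or to its right according to the sign of
  snd q - h (fst q + snd q), and larger h means smaller balance.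
\<close>

definition hpath :: "(int \<Rightarrow> int) \<Rightarrow> bool" where
  "hpath h \<longleftrightarrow> (\<forall>i. h i \<le> h (i + 1) \<and> h (i + 1) \<le> h i + 1)"

definition bal :: "(int \<times> int) set \<Rightarrow> (int \<Rightarrow> int) \<Rightarrow> int" where
  "bal P h = (\<Sum>q\<in>P. sgn (snd q - h (fst q + snd q)))"

lemma hpath_bounds:
  assumes "hpath h" and "i \<le> j"
  shows "h i \<le> h j" and "h j \<le> h i + (j - i)"
proof -
  have "h i \<le> h j \<and> h j \<le> h i + (j - i)"
    using assms(2)
  proof (induction j rule: int_ge_induct)
    case base
    show ?case by simp
  next
    case (step j)
    moreover have "h j \<le> h (j + 1) \<and> h (j + 1) \<le> h j + 1"
      using assms(1) by (simp add: hpath_def)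
    ultimately show ?case by linarith
  qed
  then show "h i \<le> h j" and "h j \<le> h i + (j - i)" by auto
qed

lemma hpath_const: "hpath (\<lambda>_. c)"
  by (simp add: hpath_def)

lemma hpath_shift: "hpath (\<lambda>i. i - c)"
  by (simp add: hpath_def)

lemma hpath_max: "hpath h \<Longrightarrow> hpath g \<Longrightarrow> hpath (\<lambda>i. max (h i) (g i))"
  unfolding hpath_def max_def by (smt (verit))

lemma hpath_min: "hpath h \<Longrightarrow> hpath g \<Longrightarrow> hpath (\<lambda>i. min (h i) (g i))"
  unfolding hpath_def min_def by (smt (verit))

text \<open>This is the path after a half-turn about the origin.\<close>

lemma hpath_reverse: "hpath h \<Longrightarrow> hpath (\<lambda>i. - h (- i))"
  unfolding hpath_def
proof
  fix i
  assume "\<forall>i. h i \<le> h (i + 1) \<and> h (i + 1) \<le> h i + 1"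
  from spec[OF this, of "- i - 1"]
  show "- h (- i) \<le> - h (- (i + 1)) \<and> - h (- (i + 1)) \<le> - h (- i) + 1" by simp
qed

lemmas hpath_intros = hpath_const hpath_shift hpath_max hpath_min

lemma bal_antimono:
  assumes "\<And>i. h i \<le> g i"
  shows "bal P g \<le> bal P h"
  unfolding bal_def
proof (rule sum_mono)
  fix q :: "int \<times> int"
  show "sgn (snd q - g (fst q + snd q)) \<le> sgn (snd q - h (fst q + snd q))"
    using assms[of "fst q + snd q"] by (simp add: sgn_if)
qed

text \<open>Raising the height at \<open>i\<close> moves the old vertex from the path to its right
  side and the new vertex from the left side onto the path, so each of them lying in
  \<open>P\<close> costs 1. Only the diagonals that meet \<open>P\<close> matter.\<close>

lemma bal_flip:
  assumes "finite P"
    and "\<And>q. q \<in> P \<Longrightarrow> g (fst q + snd q) = h (fst q + snd q) + of_bool (fst q + snd q = i)"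
  shows "bal P h = bal P g + of_bool ((i - h i, h i) \<in> P) + of_bool ((i - h i - 1, h i + 1) \<in> P)"
proof -
  have "bal P h - bal P g = (\<Sum>q\<in>P. of_bool (q = (i - h i, h i)) + of_bool (q = (i - h i - 1, h i + 1)))"
    unfolding bal_def sum_subtractf[symmetric]
  proof (rule sum.cong)
    fix q
    assume "q \<in> P"
    obtain x y where q: "q = (x, y)" by (cases q)
    show "sgn (snd q - h (fst q + snd q)) - sgn (snd q - g (fst q + snd q)) =
        of_bool (q = (i - h i, h i)) + of_bool (q = (i - h i - 1, h i + 1))"
    proof (cases "x + y = i")
      case True
      then have "g i = h i + 1"
        using assms(2)[OF \<open>q \<in> P\<close>] q by simp
      moreover have "x = i - y"
        using True by simp
      ultimately show ?thesis
        unfolding q by (auto simp: sgn_if)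
    next
      case False
      then have "g (x + y) = h (x + y)"
        using assms(2)[OF \<open>q \<in> P\<close>] q by simp
      then show ?thesis
        using False unfolding q by auto
    qed
  qed simp
  also have "\<dots> = of_bool ((i - h i, h i) \<in> P) + of_bool ((i - h i - 1, h i + 1) \<in> P)"
    using assms(1) by (simp add: sum.distrib of_bool_def)
  finally show ?thesis by simp
qed

text \<open>\<open>W\<close> will be the set of diagonals meeting \<open>P\<close>. Diagonals
  outside \<open>W\<close> may rise along with \<open>i\<close>, which does not affect the
  balance.\<close>

lemma hpath_flip:
  assumes "hpath h" "hpath g" "\<And>i. h i \<le> g i" "finite W" "j \<in> W" "h j < g j"
  obtains z i where "i \<in> W" "hpath z" "\<And>k. h k \<le> z k" "\<And>k. z k \<le> g k"
    "\<And>k. k \<in> W \<Longrightarrow> z k = h k + of_bool (k = i)"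
proof -
  define D where "D = {k \<in> W. h k < g k}"
  \<comment> \<open>c changes by 1 in every step, and h can be raised at a single index exactly at the local minima of c\<close>
  define c where "c k = 2 * h k - k" for k
  have "finite D" "D \<noteq> {}"
    using assms(4-6) by (auto simp: D_def)
  then obtain i where i: "i \<in> D" and least: "\<And>k. k \<in> D \<Longrightarrow> c i \<le> c k"
    using ex_min_if_finite[of "c ` D"] by (metis (no_types, lifting) arg_min_if_finite(1) arg_min_least)
  \<comment> \<open>The \<open>min\<close> is the lowest height function with value
    \<open>h i + 1\<close> at \<open>i\<close>. Hence it stays below \<open>g\<close>, and
    \<open>z\<close> is the least one above \<open>h\<close> that rises at \<open>i\<close>.\<close>
  define z where "z k = max (h k) (min (h i + 1) (k - (i - h i - 1)))" for k
  have z: "hpath z"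
    unfolding z_def using assms(1) by (intro hpath_intros)
  have le: "h k \<le> z k" for k
    by (simp add: z_def)
  have ge: "z k \<le> g k" for k
  proof -
    have "h i + 1 \<le> g i" using i by (simp add: D_def)
    moreover have "g i \<le> g k" if "i \<le> k" using hpath_bounds(1)[OF assms(2) that] .
    moreover have "g i \<le> g k + (i - k)" if "k \<le> i" using hpath_bounds(2)[OF assms(2) that] .
    ultimately show ?thesis
      using assms(3)[of k] unfolding z_def by (cases "i \<le> k") auto
  qed
  have "z k = h k + of_bool (k = i)" if "k \<in> W" for k
  proof (rule ccontr)
    assume neq: "z k \<noteq> h k + of_bool (k = i)"
    have "z i = h i + 1" by (simp add: z_def)
    with neq have "k \<noteq> i" by auto
    with neq le[of k] have less: "h k < z k" by simp
    with ge[of k] that have "k \<in> D" by (simp add: D_def)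
    from least[OF this] have "2 * h i - i \<le> 2 * h k - k" by (simp add: c_def)
    moreover have "h i \<le> h k" if "i \<le> k" using hpath_bounds(1)[OF assms(1) that] .
    moreover have "h i \<le> h k + (i - k)" if "k \<le> i" using hpath_bounds(2)[OF assms(1) that] .
    ultimately show False
      using less \<open>k \<noteq> i\<close> unfolding z_def by (cases "i \<le> k") auto
  qed
  with i z le ge show ?thesis
    by (intro that[of i z]) (auto simp: D_def)
qed

text \<open>A discrete intermediate value argument: \<open>z\<close> is the path just after the
  change of sign, with new vertex \<open>(i - z i, z i)\<close>, and
  \<open>(i - z i + 1, z i - 1)\<close> is the vertex it left behind on its right.\<close>

lemma transition:
  assumes "finite P" and nz: "\<And>h. hpath h \<Longrightarrow> bal P h \<noteq> 0"
    and "hpath h" "hpath g" "\<And>i. h i \<le> g i" "bal P h > 0" "bal P g < 0"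
  obtains z i where "hpath z" "\<And>k. h k \<le> z k" "\<And>k. z k \<le> g k" "bal P z = - 1" "h i < z i"
    "(i - z i, z i) \<in> P" "(i - z i + 1, z i - 1) \<in> P"
proof -
  define W where "W = (\<lambda>q. fst q + snd q) ` P"
  have W: "finite W" using assms(1) by (simp add: W_def)
  have "\<exists>z i. hpath z \<and> (\<forall>k. h k \<le> z k \<and> z k \<le> g k) \<and> bal P z = - 1 \<and> h i < z i \<and>
    (i - z i, z i) \<in> P \<and> (i - z i + 1, z i - 1) \<in> P"
    using assms(3,5,6)
  \<comment> \<open>The upper path stays fixed while the lower one climbs; the measure is the gap
    between them on \<open>W\<close>.\<close>
  proof (induction "nat (\<Sum>k\<in>W. g k - h k)" arbitrary: h rule: less_induct)
    case less
    have "\<exists>j\<in>W. h j < g j"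
    proof (rule ccontr)
      assume "\<not> ?thesis"
      then have "bal P h = bal P g"
        unfolding bal_def using less.prems(2) by (intro sum.cong refl arg_cong[of _ _ sgn])
            (force simp: W_def not_less intro!: antisym)
      with less.prems assms(7) show False by simp
    qed
    then obtain j where "j \<in> W" "h j < g j" by auto
    then obtain z i where z: "i \<in> W" "hpath z" "\<And>k. h k \<le> z k" "\<And>k. z k \<le> g k"
      and zW: "\<And>k. k \<in> W \<Longrightarrow> z k = h k + of_bool (k = i)"
      using hpath_flip[OF less.prems(1) assms(4) less.prems(2) W] by metis
    have fl: "bal P h = bal P z + of_bool ((i - h i, h i) \<in> P) + of_bool ((i - h i - 1, h i + 1) \<in> P)"
      by (rule bal_flip[OF assms(1)]) (use zW in \<open>auto simp: W_def\<close>)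
    have zi: "z i = h i + 1" using zW[OF z(1)] by simp
    show ?case
    proof (cases "bal P z > 0")
      case True
      have "(\<Sum>k\<in>W. g k - z k) < (\<Sum>k\<in>W. g k - h k)"
        using W z(1,3) zi by (intro sum_strict_mono_ex1) (auto intro: bexI[of _ i])
      moreover have "0 \<le> (\<Sum>k\<in>W. g k - z k)"
        using z(4) by (intro sum_nonneg) simp
      ultimately have "nat (\<Sum>k\<in>W. g k - z k) < nat (\<Sum>k\<in>W. g k - h k)" by simp
      from less.hyps[OF this z(2) z(4) True] z(3) show ?thesis
        by (smt (verit))
    next
      case False
      with nz[OF z(2)] have "bal P z < 0" by simp
      with fl less.prems(3)
      have "bal P z = - 1" "(i - h i, h i) \<in> P" "(i - h i - 1, h i + 1) \<in> P"
        by (auto simp: of_bool_def split: if_splits)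
      then show ?thesis
        using z zi by (intro exI[of _ z] exI[of _ i]) (auto simp: algebra_simps)
    qed
  qed
  then obtain z i where "hpath z" "\<forall>k. h k \<le> z k \<and> z k \<le> g k" "bal P z = - 1" "h i < z i"
    "(i - z i, z i) \<in> P" "(i - z i + 1, z i - 1) \<in> P" by blast
  then show ?thesis by (intro that[of z i]) auto
qed

section \<open>Reflections in the coordinate axes\<close>

definition mirror_x :: "int \<times> int \<Rightarrow> int \<times> int" where
  "mirror_x q = (- fst q, snd q)"

definition mirror_y :: "int \<times> int \<Rightarrow> int \<times> int" where
  "mirror_y q = (fst q, - snd q)"

lemma mirror_simps [simp]:
  "mirror_x (x, y) = (- x, y)" "mirror_y (x, y) = (x, - y)"
  "mirror_x (mirror_x q) = q" "mirror_y (mirror_y q) = q"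
  by (simp_all add: mirror_x_def mirror_y_def)

lemma mem_mirror [simp]:
  "q \<in> mirror_x ` P \<longleftrightarrow> mirror_x q \<in> P" "q \<in> mirror_y ` P \<longleftrightarrow> mirror_y q \<in> P"
  by (metis imageE imageI mirror_simps(3), metis imageE imageI mirror_simps(4))

text \<open>Seen from \<open>P\<close>, the function \<open>h\<close> describes a downhill path by
  its heights on the diagonals y - x = i.\<close>

lemma bal_mirror_x: "bal (mirror_x ` P) h = (\<Sum>q\<in>P. sgn (snd q - h (snd q - fst q)))"
proof -
  have "inj_on mirror_x P" by (metis inj_onI mirror_simps(3))
  then show ?thesis
    unfolding bal_def by (subst sum.reindex) (auto simp: mirror_x_def)
qed

lemma bal_mirror_y: "bal (mirror_y ` P) h = (\<Sum>q\<in>P. sgn (- snd q - h (fst q - snd q)))"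
proof -
  have "inj_on mirror_y P" by (metis inj_onI mirror_simps(4))
  then show ?thesis
    unfolding bal_def by (subst sum.reindex) (auto simp: mirror_y_def)
qed

text \<open>The two signs are the contributions of one point to the balances of \<open>f\<close> and
  \<open>g\<close> in \<open>Q1_nonempty\<close>. In the third quadrant \<open>f\<close> lies above
  \<open>g\<close> and gains nothing; in the second and fourth the signs differ only at the two
  points named.\<close>

lemma staircase_sgn_diff:
  fixes x y T M b :: int
  assumes "x \<le> T \<or> y \<le> M" "b < T"
  shows "sgn (y - max M (min (x + y - (T + 1)) (M + 1)))
      - sgn (y - max (min (x + y - T) (M + 1)) (x + y - (T + 1)))
    \<le> of_bool (x = T \<and> y = M + 1) + of_bool (x = T + 1 \<and> y = M) - of_bool (x = b \<and> y = M)"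
proof -
  define u v where "u = x - T" and "v = y - M"
  have *: "x + y - (T + 1) = u + v + M - 1" "x + y - T = u + v + M" by (auto simp: u_def v_def)
  \<comment> \<open>Third quadrant off column \<open>T\<close> and on it, second quadrant in row
    \<open>M + 1\<close> and above it, fourth quadrant.\<close>
  consider "u < 0" "v \<le> 0" | "u = 0" "v \<le> 0" | "u \<le> 0" "v = 1" | "u \<le> 0" "v > 1" | "u \<ge> 1" "v \<le> 0"
    using assms(1) by (fastforce simp: u_def v_def)
  then show ?thesis
    by cases (use assms(2) in \<open>unfold *, auto simp: u_def v_def sgn_if max_def min_def\<close>)
qed

text \<open>Stated through height functions only, so that reflections preserve it:
  \<open>down_nz\<close> excludes friendly downhill paths, and \<open>\<lambda>i. i - T\<close> is
  the vertical line x = T.\<close>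

locale quartered =
  fixes P :: "(int \<times> int) set" and M T :: int
  assumes fin: "finite P"
    and up_nz: "hpath h \<Longrightarrow> bal P h \<noteq> 0"
    and down_nz: "hpath h \<Longrightarrow> bal (mirror_x ` P) h \<noteq> 0"
    and row_M: "bal P (\<lambda>_. M) > 0" and row_Suc: "bal P (\<lambda>_. M + 1) < 0"
    and col_T: "bal P (\<lambda>i. i - T) < 0" and col_Suc: "bal P (\<lambda>i. i - (T + 1)) > 0"
begin

text \<open>Columns \<open>T\<close> and \<open>T + 1\<close> go to \<open>- T\<close> and
  \<open>- T - 1\<close>; their order is reversed, but so are the signs of their balances.\<close>

lemma quartered_mirror_x: "quartered (mirror_x ` P) M (- T - 1)"
proof
  show "finite (mirror_x ` P)" using fin by simp
  show "bal (mirror_x ` P) h \<noteq> 0" if "hpath h" for h using down_nz[OF that] .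
  have "mirror_x ` mirror_x ` P = P" by (simp add: image_image)
  then show "bal (mirror_x ` mirror_x ` P) h \<noteq> 0" if "hpath h" for h using up_nz[OF that] by simp
  have row: "bal (mirror_x ` P) (\<lambda>_. c) = bal P (\<lambda>_. c)" for c
    by (simp only: bal_mirror_x) (simp add: bal_def)
  show "0 < bal (mirror_x ` P) (\<lambda>_. M)" "bal (mirror_x ` P) (\<lambda>_. M + 1) < 0"
    using row_M row_Suc row by simp_all
  have col: "bal (mirror_x ` P) (\<lambda>i. i - c) = - bal P (\<lambda>i. i - (- c))" for c
    unfolding bal_mirror_x unfolding bal_def sum_negf[symmetric]
    by (intro sum.cong) (auto simp: sgn_if)
  show "bal (mirror_x ` P) (\<lambda>i. i - (- T - 1)) < 0"
    "0 < bal (mirror_x ` P) (\<lambda>i. i - (- T - 1 + 1))"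
    unfolding col using col_T col_Suc by (simp_all add: add.commute)
qed

lemma quartered_mirror_y: "quartered (mirror_y ` P) (- M - 1) T"
proof
  show "finite (mirror_y ` P)" using fin by simp
  \<comment> \<open>The two reflections differ by a half-turn, which swaps the sides of an uphill
    path.\<close>
  have neg: "bal (mirror_y ` P) h = - bal (mirror_x ` P) (\<lambda>i. - h (- i))" for h
    unfolding bal_mirror_x bal_mirror_y sum_negf[symmetric]
    by (intro sum.cong) (auto simp: sgn_if)
  show "bal (mirror_y ` P) h \<noteq> 0" if "hpath h" for h
    using down_nz[OF hpath_reverse[OF that]] neg by simp
  have "bal (mirror_x ` mirror_y ` P) h = - bal P (\<lambda>i. - h (- i))" for h
  proof -
    have "inj_on mirror_y P" by (metis inj_onI mirror_simps(4))
    then have "bal (mirror_x ` mirror_y ` P) h = (\<Sum>q\<in>P. sgn (- snd q - h (- snd q - fst q)))"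
      unfolding bal_mirror_x by (subst sum.reindex) (simp_all add: mirror_y_def)
    also have "\<dots> = (\<Sum>q\<in>P. - sgn (snd q + h (- (fst q + snd q))))"
    proof (intro sum.cong refl)
      fix q :: "int \<times> int"
      have "- snd q - fst q = - (fst q + snd q)" by simp
      then show "sgn (- snd q - h (- snd q - fst q)) = - sgn (snd q + h (- (fst q + snd q)))"
        by (simp only: sgn_if) auto
    qed
    finally show ?thesis by (simp add: bal_def sum_negf)
  qed
  then show "bal (mirror_x ` mirror_y ` P) h \<noteq> 0" if "hpath h" for h
    using up_nz[OF hpath_reverse[OF that]] by simp
  have row: "bal (mirror_y ` P) (\<lambda>_. c) = - bal P (\<lambda>_. - c)" for c
    unfolding bal_mirror_y unfolding bal_def sum_negf[symmetric] by (intro sum.cong) (auto simp: sgn_if)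
  show "0 < bal (mirror_y ` P) (\<lambda>_. - M - 1)" "bal (mirror_y ` P) (\<lambda>_. - M - 1 + 1) < 0"
    unfolding row using row_M row_Suc by (simp_all add: add.commute)
  have col: "bal (mirror_y ` P) (\<lambda>i. i - c) = bal P (\<lambda>i. i - c)" for c
    unfolding bal_mirror_y unfolding bal_def by (intro sum.cong) (auto simp: sgn_if)
  show "bal (mirror_y ` P) (\<lambda>i. i - T) < 0" "0 < bal (mirror_y ` P) (\<lambda>i. i - (T + 1))"
    unfolding col using col_T col_Suc by simp_all
qed

section \<open>Points in the first quadrant of a quartered set\<close>

lemma diagonal_step:
  assumes "T < x" "M < y"
  shows "(x + 1, y) \<in> P \<longleftrightarrow> (x, y + 1) \<in> P"
proof -
  define s where "s = x + y + 1"
  \<comment> \<open>\<open>h\<close> climbs column \<open>x\<close> to height \<open>y + 1\<close>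
    and then goes right; \<open>g\<close> follows row \<open>y\<close> to \<open>(x, y)\<close>,
    turns up to \<open>(x, y + 1)\<close>, right to \<open>(x + 1, y + 1)\<close> and climbs. Every
    path between them passes through these three points.\<close>
  define h where "h i = min (i - x) (y + 1)" for i
  define g where "g i = max (max y (min (i - x) (y + 1))) (i - (x + 1))" for i
  have "hpath h" "hpath g"
    unfolding h_def g_def by (intro hpath_intros)+
  have "bal P h \<ge> bal P (\<lambda>i. i - (T + 1))"
    by (rule bal_antimono) (use assms in \<open>auto simp: h_def\<close>)
  then have "bal P h > 0" using col_Suc by simp
  have "bal P g \<le> bal P (\<lambda>_. M + 1)"
    by (rule bal_antimono) (use assms in \<open>auto simp: g_def\<close>)
  then have "bal P g < 0" using row_Suc by simp
  have "h i \<le> g i" for i by (simp add: h_def g_def)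
  from transition[OF fin up_nz \<open>hpath h\<close> \<open>hpath g\<close> this \<open>bal P h > 0\<close> \<open>bal P g < 0\<close>]
  obtain z where z: "hpath z" "\<And>k. h k \<le> z k" "\<And>k. z k \<le> g k" "bal P z = - 1"
    by metis
  have zs: "z (s - 1) = y" "z s = y + 1" "z (s + 1) = y + 1"
    using z(2)[of "s - 1"] z(3)[of "s - 1"] z(2)[of s] z(3)[of s] z(2)[of "s + 1"] z(3)[of "s + 1"]
    by (auto simp: s_def h_def g_def)
  \<comment> \<open>The corner of \<open>z\<close> at \<open>(x, y + 1)\<close> is flipped down to
    \<open>(x + 1, y)\<close>. The new balance is -1 plus the number of these two points in
    \<open>P\<close>, so that number is not 1.\<close>
  define w where "w = z(s := y)"
  have "hpath w"
    unfolding hpath_def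
  proof
    fix i
    have "z i \<le> z (i + 1) \<and> z (i + 1) \<le> z i + 1" using z(1) by (simp add: hpath_def)
    then show "w i \<le> w (i + 1) \<and> w (i + 1) \<le> w i + 1"
      using zs by (cases "i = s"; cases "i = s - 1") (auto simp: w_def)
  qed
  have "bal P w = bal P z + of_bool ((s - w s, w s) \<in> P) + of_bool ((s - w s - 1, w s + 1) \<in> P)"
    by (rule bal_flip[OF fin]) (auto simp: w_def zs)
  also have "\<dots> = of_bool ((x + 1, y) \<in> P) + of_bool ((x, y + 1) \<in> P) - 1"
    by (simp add: z w_def s_def algebra_simps)
  finally show ?thesis
    using up_nz[OF \<open>hpath w\<close>] by (auto simp: of_bool_def split: if_splits)
qed

lemma diagonal:
  assumes "1 \<le> x" "1 \<le> y"
  shows "(T + x, M + y) \<in> P \<longleftrightarrow> (T + 1, M + (x + y - 1)) \<in> P"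
  using assms
proof (induction x arbitrary: y rule: int_ge_induct)
  case base
  show ?case by simp
next
  case (step x)
  have "(T + (x + 1), M + y) \<in> P \<longleftrightarrow> (T + x, M + (y + 1)) \<in> P"
    using diagonal_step[of "T + x" "M + y"] step.hyps step.prems by (simp add: add.assoc)
  also have "\<dots> \<longleftrightarrow> (T + 1, M + (x + (y + 1) - 1)) \<in> P"
    using step.IH[of "y + 1"] step.prems by simp
  finally show ?case by (simp add: algebra_simps)
qed

text \<open>A sweep from row \<open>M\<close> to row \<open>M + 1\<close> exchanges two points of
  \<open>P\<close>, one in each row. The upper one cannot lie in the second quadrant, and the lower
  one is a column further right.\<close>

lemma row_point_if_Q2_empty:
  assumes "\<And>x y. (x, y) \<in> P \<Longrightarrow> x \<le> T \<Longrightarrow> y \<le> M"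
  obtains x where "(x, M) \<in> P" "T + 2 \<le> x"
proof -
  obtain z i where z: "\<And>k. M \<le> z k" "\<And>k. z k \<le> M + 1" "M < z i"
    and mem: "(i - z i, z i) \<in> P" "(i - z i + 1, z i - 1) \<in> P"
    using transition[OF fin up_nz hpath_const hpath_const _ row_M row_Suc, simplified] by metis
  have "z i = M + 1" using z(2)[of i] z(3) by simp
  then have "T < i - (M + 1)" using mem(1) assms[OF mem(1)] by fastforce
  with mem(2) \<open>z i = M + 1\<close> show ?thesis
    by (intro that[of "i - M"]) simp_all
qed

text \<open>
  If the first quadrant contains no point of P, then f (along y = M to x = T + 1, up to y = M + 1,
  and on to the right) has positive balance and g (along x = T up to y = M + 1, right to x = T + 1,
  and on upwards) has negative balance. But f has a larger contribution than g only at the points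
  (T, M + 1) and (T + 1, M), and a smaller one at a point (b, M) with b < T that a sweep of
  downhill paths between the rows M and M + 1 provides.
\<close>

lemma Q1_nonempty: "\<exists>x y. T < x \<and> M < y \<and> (x, y) \<in> P"
proof (rule ccontr)
  assume "\<not> ?thesis"
  then have Q1: "y \<le> M" if "(x, y) \<in> P" "T < x" for x y using that by (meson not_le)
  interpret mirrored: quartered "mirror_x ` P" M "- T - 1" by (rule quartered_mirror_x)
  obtain b where b: "(b, M) \<in> P" "b < T"
  proof (rule mirrored.row_point_if_Q2_empty)
    fix x y
    assume "(x, y) \<in> mirror_x ` P" "x \<le> - T - 1"
    then show "y \<le> M" using Q1[of "- x" y] by simp
  next
    fix x
    assume "(x, M) \<in> mirror_x ` P" "- T - 1 + 2 \<le> x"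
    then show thesis using that[of "- x"] by simp
  qed
  define f where "f i = max M (min (i - (T + 1)) (M + 1))" for i
  define g where "g i = max (min (i - T) (M + 1)) (i - (T + 1))" for i
  have f: "hpath f" and g: "hpath g"
    unfolding f_def g_def by (intro hpath_intros)+
  have "bal P f > 0"
  \<comment> \<open>Otherwise a sweep from row \<open>M\<close> to \<open>f\<close> passes a point
    of \<open>P\<close> above row \<open>M\<close> and not above \<open>f\<close>, hence in the
    first quadrant.\<close>
  proof (rule ccontr)
    assume "\<not> ?thesis"
    with up_nz[OF f] have "bal P f < 0" by simp
    have "M \<le> f i" for i by (simp add: f_def)
    from transition[OF fin up_nz hpath_const f this row_M \<open>bal P f < 0\<close>]
    obtain z i where z: "z i \<le> f i" "M < z i" "(i - z i, z i) \<in> P" by metis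
    have "T < i - z i" using z(1,2) unfolding f_def by linarith
    with Q1[OF z(3)] z(2) show False by simp
  qed
  moreover have "bal P g < 0"
  \<comment> \<open>Otherwise a sweep from \<open>g\<close> to column \<open>T\<close> leaves behind
    a point of \<open>P\<close> in the first quadrant.\<close>
  proof (rule ccontr)
    assume "\<not> ?thesis"
    with up_nz[OF g] have "bal P g > 0" by simp
    have "g i \<le> i - T" for i by (simp add: g_def)
    from transition[OF fin up_nz g hpath_shift this \<open>bal P g > 0\<close> col_T]
    obtain z i where z: "z i \<le> i - T" "g i < z i" "(i - z i + 1, z i - 1) \<in> P" by metis
    have "T < i - z i + 1" "M < z i - 1" using z(1,2) unfolding g_def by linarith+
    with Q1[OF z(3)] show False by simp
  qed
  \<comment> \<open>A positive and a negative integer differ by at least 2; the loss at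
    \<open>(b, M)\<close> keeps the difference below that.\<close>
  moreover have "bal P f - bal P g \<le> 1"
  proof -
    have "bal P f - bal P g = (\<Sum>q\<in>P. sgn (snd q - f (fst q + snd q)) - sgn (snd q - g (fst q + snd q)))"
      by (simp add: bal_def sum_subtractf)
    also have "\<dots> \<le> (\<Sum>q\<in>P. of_bool (q = (T, M + 1)) + of_bool (q = (T + 1, M)) - of_bool (q = (b, M)))"
    proof (rule sum_mono)
      fix q
      assume "q \<in> P"
      obtain x y where q: "q = (x, y)" by (cases q)
      show "sgn (snd q - f (fst q + snd q)) - sgn (snd q - g (fst q + snd q))
        \<le> of_bool (q = (T, M + 1)) + of_bool (q = (T + 1, M)) - of_bool (q = (b, M))"
        using Q1[of x y] \<open>q \<in> P\<close> staircase_sgn_diff[of x T y M b] b(2) unfolding q f_def g_def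
        by (cases "T < x") simp_all
    qed
    also have "\<dots> \<le> 1"
      using fin b(1) by (simp add: sum.distrib sum_subtractf of_bool_def)
    finally show ?thesis .
  qed
  ultimately show False by linarith
qed

end

section \<open>The two sides of a monotone path\<close>

text \<open>
  The parameter s is 1 for uphill and -1 for downhill paths. Each region is a union of open
  quadrants with apex on the path, any two of which intersect.
\<close>

definition left_region :: "int \<Rightarrow> (int \<Rightarrow> int \<times> int) \<Rightarrow> (real \<times> real) set" where
  "left_region s p = (\<Union>i. {z. fst z < of_int (fst (p i)) \<and> of_int (s * snd (p i)) < of_int s * snd z})"

definition right_region :: "int \<Rightarrow> (int \<Rightarrow> int \<times> int) \<Rightarrow> (real \<times> real) set" where
  "right_region s p = (\<Union>i. {z. of_int (fst (p i)) < fst z \<and> of_int s * snd z < of_int (s * snd (p i))})"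

lemma connected_UN_pairwise:
  assumes "\<And>i. i \<in> I \<Longrightarrow> connected (A i)" and "\<And>i j. i \<in> I \<Longrightarrow> j \<in> I \<Longrightarrow> A i \<inter> A j \<noteq> {}"
  shows "connected (\<Union>i\<in>I. A i)"
  unfolding connected_iff_connected_component
proof (intro ballI)
  fix x y
  assume "x \<in> (\<Union>i\<in>I. A i)" "y \<in> (\<Union>i\<in>I. A i)"
  then obtain i j where ij: "i \<in> I" "x \<in> A i" "j \<in> I" "y \<in> A j" by blast
  then have "connected (A i \<union> A j)" by (intro connected_Un assms)
  then show "connected_component (\<Union>i\<in>I. A i) x y"
    unfolding connected_component_def using ij by (intro exI[of _ "A i \<union> A j"]) auto
qed

lemma half_plane_convex:
  "convex {z :: real \<times> real. fst z < a}" "convex {z :: real \<times> real. a < fst z}"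
  "convex {z :: real \<times> real. c * snd z < a}" "convex {z :: real \<times> real. a < c * snd z}"
  using convex_halfspace_lt[of "(1, 0) :: real \<times> real" a] convex_halfspace_gt[of a "(1, 0) :: real \<times> real"]
    convex_halfspace_lt[of "(0, c) :: real \<times> real" a] convex_halfspace_gt[of a "(0, c) :: real \<times> real"]
  by (simp_all add: inner_prod_def)

locale monotone_path =
  fixes s :: int and p :: "int \<Rightarrow> int \<times> int"
  assumes s: "s = 1 \<or> s = - 1" and step: "p (i + 1) - p i \<in> {(1, 0), (0, s)}"
begin

lemma vertex_step:
  "fst (p (i + 1)) = fst (p i) + 1 \<and> snd (p (i + 1)) = snd (p i) \<or>
   fst (p (i + 1)) = fst (p i) \<and> snd (p (i + 1)) = snd (p i) + s"
  using step[of i] by (auto simp: prod_eq_iff algebra_simps)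

lemma vertex_mono:
  assumes "i \<le> j"
  shows "fst (p i) \<le> fst (p j)" and "s * snd (p i) \<le> s * snd (p j)"
proof -
  have "fst (p i) \<le> fst (p j) \<and> s * snd (p i) \<le> s * snd (p j)"
    using assms
  proof (induction j rule: int_ge_induct)
    case base
    show ?case by simp
  next
    case (step j)
    with vertex_step[of j] s show ?case by (auto simp: algebra_simps)
  qed
  then show "fst (p i) \<le> fst (p j)" and "s * snd (p i) \<le> s * snd (p j)" by auto
qed

lemma vertex_sum: "fst (p i) + s * snd (p i) = fst (p 0) + s * snd (p 0) + i"
proof (induction i rule: int_induct[where k = 0])
  case base
  show ?case by simp
next
  case (step1 i)
  with vertex_step[of i] s show ?case by (auto simp: algebra_simps)
next
  case (step2 i)
  with vertex_step[of "i - 1"] s show ?case by (auto simp: algebra_simps)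
qed

text \<open>One coordinate is constant along a step, so the segment is a degenerate box; the factor
  \<open>s\<close> puts the vertical bounds in increasing order for downhill paths too.\<close>

lemma mem_step_segment:
  "z \<in> closed_segment (real_pt (p i)) (real_pt (p (i + 1))) \<longleftrightarrow>
   of_int (fst (p i)) \<le> fst z \<and> fst z \<le> of_int (fst (p (i + 1))) \<and>
   of_int (s * snd (p i)) \<le> of_int s * snd z \<and> of_int s * snd z \<le> of_int (s * snd (p (i + 1)))"
proof -
  define a b where "a = real_of_int (fst (p i))" and "b = real_of_int (snd (p i))"
  obtain x y where z: "z = (x, y)" by (cases z)
  from vertex_step[of i] show ?thesis
  proof
    assume *: "fst (p (i + 1)) = fst (p i) + 1 \<and> snd (p (i + 1)) = snd (p i)"
    have "z \<in> closed_segment (a, b) (a + 1, b) \<longleftrightarrow> a \<le> x \<and> x \<le> a + 1 \<and> y = b"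
      unfolding z in_segment by (auto simp: algebra_simps intro!: exI[of _ "x - a"])
    then show ?thesis
      using * s unfolding z real_pt_def a_def b_def by auto
  next
    assume *: "fst (p (i + 1)) = fst (p i) \<and> snd (p (i + 1)) = snd (p i) + s"
    have "z \<in> closed_segment (a, b) (a, b + of_int s) \<longleftrightarrow>
        x = a \<and> 0 \<le> of_int s * (y - b) \<and> of_int s * (y - b) \<le> 1"
      unfolding z in_segment using s
      by (auto simp: algebra_simps intro!: exI[of _ "of_int s * (y - b)"])
    then show ?thesis
      using * s unfolding z real_pt_def a_def b_def by (auto simp: algebra_simps)
  qed
qed

lemma open_regions: "open (left_region s p)" "open (right_region s p)"
  unfolding left_region_def right_region_def
  by (intro open_UN ballI open_Collect_conj open_Collect_less continuous_intros)+

lemma connected_regions: "connected (left_region s p)" "connected (right_region s p)"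
proof -
  have ss: "of_int s * (of_int s * c) = c" for c :: real using s by auto
  show "connected (left_region s p)"
    unfolding left_region_def
  proof (rule connected_UN_pairwise)
    fix i j
    show "connected {z. fst z < real_of_int (fst (p i)) \<and> real_of_int (s * snd (p i)) < of_int s * snd z}"
      unfolding Collect_conj_eq by (intro convex_connected convex_Int half_plane_convex)
    have "(of_int (min (fst (p i)) (fst (p j)) - 1), of_int s * of_int (max (s * snd (p i)) (s * snd (p j)) + 1))
      \<in> {z. fst z < real_of_int (fst (p i)) \<and> real_of_int (s * snd (p i)) < of_int s * snd z} \<inter>
        {z. fst z < real_of_int (fst (p j)) \<and> real_of_int (s * snd (p j)) < of_int s * snd z}"
      by (auto simp: ss min_def max_def simp del: of_int_mult)
    then show "{z. fst z < real_of_int (fst (p i)) \<and> real_of_int (s * snd (p i)) < of_int s * snd z} \<inter>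
        {z. fst z < real_of_int (fst (p j)) \<and> real_of_int (s * snd (p j)) < of_int s * snd z} \<noteq> {}"
      by blast
  qed
  show "connected (right_region s p)"
    unfolding right_region_def
  proof (rule connected_UN_pairwise)
    fix i j
    show "connected {z. real_of_int (fst (p i)) < fst z \<and> of_int s * snd z < real_of_int (s * snd (p i))}"
      unfolding Collect_conj_eq by (intro convex_connected convex_Int half_plane_convex)
    have "(of_int (max (fst (p i)) (fst (p j)) + 1), of_int s * of_int (min (s * snd (p i)) (s * snd (p j)) - 1))
      \<in> {z. real_of_int (fst (p i)) < fst z \<and> of_int s * snd z < real_of_int (s * snd (p i))} \<inter>
        {z. real_of_int (fst (p j)) < fst z \<and> of_int s * snd z < real_of_int (s * snd (p j))}"
      by (auto simp: ss min_def max_def simp del: of_int_mult)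
    then show "{z. real_of_int (fst (p i)) < fst z \<and> of_int s * snd z < real_of_int (s * snd (p i))} \<inter>
        {z. real_of_int (fst (p j)) < fst z \<and> of_int s * snd z < real_of_int (s * snd (p j))} \<noteq> {}"
      by blast
  qed
qed

lemma nonempty_regions: "left_region s p \<noteq> {}" "right_region s p \<noteq> {}"
proof -
  have ss: "of_int s * (of_int s * c) = c" for c :: real using s by auto
  have "(of_int (fst (p 0) - 1), of_int s * (of_int (s * snd (p 0) + 1))) \<in> left_region s p"
    unfolding left_region_def by (auto simp: ss simp del: of_int_mult intro!: exI[of _ 0])
  then show "left_region s p \<noteq> {}" by blast
  have "(of_int (fst (p 0) + 1), of_int s * (of_int (s * snd (p 0) - 1))) \<in> right_region s p"
    unfolding right_region_def by (auto simp: ss simp del: of_int_mult intro!: exI[of _ 0])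
  then show "right_region s p \<noteq> {}" by blast
qed

lemma disjoint_regions: "left_region s p \<inter> right_region s p = {}"
proof (rule equals0I)
  fix z
  assume "z \<in> left_region s p \<inter> right_region s p"
  then obtain i j where *: "fst z < of_int (fst (p i))" "of_int (s * snd (p i)) < of_int s * snd z"
    "of_int (fst (p j)) < fst z" "of_int s * snd z < of_int (s * snd (p j))"
    unfolding left_region_def right_region_def by auto
  have "fst (p j) < fst (p i)" "s * snd (p i) < s * snd (p j)" using * by linarith+
  with vertex_mono[of i j] vertex_mono[of j i] show False by linarith
qed

lemma Compl_path_trace: "- path_trace p = left_region s p \<union> right_region s p"
proof (intro set_eqI iffI)
  fix z
  assume z: "z \<in> - path_trace p"
  define c where "c = fst (p 0) + s * snd (p 0)"
  \<comment> \<open>By \<open>vertex_sum\<close> this is the step whose diagonal strip contains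
    \<open>z\<close>. A point of the strip outside the quadrants at both end vertices lies on the
    step.\<close>
  define i where "i = \<lfloor>fst z + of_int s * snd z\<rfloor> - c"
  have i: "of_int (fst (p i)) + of_int (s * snd (p i)) \<le> fst z + of_int s * snd z"
    "fst z + of_int s * snd z < of_int (fst (p i)) + of_int (s * snd (p i)) + 1"
    using vertex_sum[of i] unfolding i_def c_def by linarith+
  show "z \<in> left_region s p \<union> right_region s p"
  proof (rule ccontr)
    assume "\<not> ?thesis"
    then have nl: "\<not> (fst z < of_int (fst (p k)) \<and> of_int (s * snd (p k)) < of_int s * snd z)"
      and nr: "\<not> (of_int (fst (p k)) < fst z \<and> of_int s * snd z < of_int (s * snd (p k)))" for k
      unfolding left_region_def right_region_def by auto
    have "s * s = 1" using s by auto
    with vertex_step[of i]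
    have "fst (p (i + 1)) = fst (p i) + 1 \<and> s * snd (p (i + 1)) = s * snd (p i) \<or>
      fst (p (i + 1)) = fst (p i) \<and> s * snd (p (i + 1)) = s * snd (p i) + 1"
      by (auto simp: algebra_simps)
    then have "z \<in> closed_segment (real_pt (p i)) (real_pt (p (i + 1)))"
      unfolding mem_step_segment
      using i nl[of i] nr[of i] nl[of "i + 1"] nr[of "i + 1"] by linarith
    with z show False by (auto simp: path_trace_def)
  qed
next
  fix z
  assume z: "z \<in> left_region s p \<union> right_region s p"
  show "z \<in> - path_trace p"
  proof
    assume "z \<in> path_trace p"
    then obtain j where j: "of_int (fst (p j)) \<le> fst z" "fst z \<le> of_int (fst (p (j + 1)))"
      "of_int (s * snd (p j)) \<le> of_int s * snd z" "of_int s * snd z \<le> of_int (s * snd (p (j + 1)))"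
      unfolding path_trace_def by (auto simp: mem_step_segment)
    from z obtain i where
      "fst z < of_int (fst (p i)) \<and> of_int (s * snd (p i)) < of_int s * snd z \<or>
       of_int (fst (p i)) < fst z \<and> of_int s * snd z < of_int (s * snd (p i))"
      unfolding left_region_def right_region_def by auto
    \<comment> \<open>By monotonicity, one inequality of each alternative forces
      \<open>i > j\<close> and the other \<open>i < j + 1\<close>.\<close>
    with j have "fst (p j) < fst (p i) \<and> s * snd (p i) < s * snd (p (j + 1)) \<or>
      fst (p i) < fst (p (j + 1)) \<and> s * snd (p j) < s * snd (p i)" by linarith
    with vertex_mono[of i j] vertex_mono[of "j + 1" i] show False by linarith
  qed
qed

lemma components_Compl_path_trace: "components (- path_trace p) = {left_region s p, right_region s p}"
  by (rule components_open_unique)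
    (use open_regions connected_regions nonempty_regions disjoint_regions in
      \<open>auto simp: Compl_path_trace disjnt_def pairwise_def\<close>)

lemma left_region_neq_right_region: "left_region s p \<noteq> right_region s p"
  using nonempty_regions disjoint_regions by auto

lemma connected_component_region:
  "z \<in> left_region s p \<Longrightarrow> connected_component_set (- path_trace p) z = left_region s p"
  "z \<in> right_region s p \<Longrightarrow> connected_component_set (- path_trace p) z = right_region s p"
  using components_Compl_path_trace
  by (metis connected_component_eq components_iff insertI1, 
      metis connected_component_eq components_iff insertI1 insertI2)

lemma real_pt_mem_regions:
  "real_pt q \<in> left_region s p \<longleftrightarrow> (\<exists>i. fst q < fst (p i) \<and> s * snd (p i) < s * snd q)"
  "real_pt q \<in> right_region s p \<longleftrightarrow> (\<exists>i. fst (p i) < fst q \<and> s * snd q < s * snd (p i))"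
  unfolding left_region_def right_region_def real_pt_def
  by (simp_all add: of_int_mult[symmetric] del: of_int_mult)

end

section \<open>Inseparable sets\<close>

lemma sum_sgn_eq_card_diff:
  fixes f :: "'a \<Rightarrow> int"
  assumes "finite A"
  shows "(\<Sum>x\<in>A. sgn (f x)) = int (card {x \<in> A. 0 < f x}) - int (card {x \<in> A. f x < 0})"
proof -
  have "(\<Sum>x\<in>A. sgn (f x)) = (\<Sum>x\<in>A. of_bool (0 < f x) - of_bool (f x < 0))"
    by (intro sum.cong) (auto simp: sgn_if)
  then show ?thesis
    using assms by (simp add: sum_subtractf Int_def)
qed

text \<open>Any apex \<open>i\<close> can be replaced by the vertex on the antidiagonal of the point
  itself, since both coordinates are monotone along the path. This links quadrant regions to signs
  in \<open>bal\<close>.\<close>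

lemma above_hpath_iff:
  assumes "hpath h"
  shows "(\<exists>i. x < i - h i \<and> h i < y) \<longleftrightarrow> h (x + y) < y"
proof
  assume "\<exists>i. x < i - h i \<and> h i < y"
  then obtain i where "x < i - h i" "h i < y" by auto
  with hpath_bounds[OF assms, of i "x + y"] hpath_bounds[OF assms, of "x + y" i]
  show "h (x + y) < y" by linarith
qed (auto intro!: exI[of _ "x + y"])

lemma below_hpath_iff:
  assumes "hpath h"
  shows "(\<exists>i. i - h i < x \<and> y < h i) \<longleftrightarrow> y < h (x + y)"
proof
  assume "\<exists>i. i - h i < x \<and> y < h i"
  then obtain i where "i - h i < x" "y < h i" by auto
  with hpath_bounds[OF assms, of i "x + y"] hpath_bounds[OF assms, of "x + y" i]
  show "y < h (x + y)" by linarith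
qed (auto intro!: exI[of _ "x + y"])

lemma inseparable_card_regions:
  assumes "inseparable_set n P" and "monotone_path s p"
  shows "card {q \<in> P. real_pt q \<in> left_region s p} \<noteq> card {q \<in> P. real_pt q \<in> right_region s p}"
proof
  interpret monotone_path s p by fact
  assume *: "card {q \<in> P. real_pt q \<in> left_region s p} = card {q \<in> P. real_pt q \<in> right_region s p}"
  have "monotone_lattice_path (path_trace p)"
    unfolding monotone_lattice_path_def uphill_def downhill_def using s step by auto
  then have "friendly_path P (path_trace p)"
    unfolding friendly_path_def
    using * components_Compl_path_trace left_region_neq_right_region by blast
  with assms(1) show False by (auto simp: inseparable_set_def)
qed

lemma inseparable_bal_nonzero:
  assumes P: "inseparable_set n P" and h: "hpath h"
  shows "bal P h \<noteq> 0"
proof -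
  define p where "p i = (i - h i, h i)" for i
  interpret monotone_path 1 p
  proof
    fix i
    have "h (i + 1) = h i \<or> h (i + 1) = h i + 1"
      using h unfolding hpath_def by (metis add1_zle_eq antisym_conv not_le)
    then show "p (i + 1) - p i \<in> {(1, 0), (0, 1)}" by (auto simp: p_def)
  qed simp
  have "finite P" using P by (simp add: inseparable_set_def)
  then have "bal P h = int (card {q \<in> P. real_pt q \<in> left_region 1 p}) - int (card {q \<in> P. real_pt q \<in> right_region 1 p})"
    by (simp add: bal_def sum_sgn_eq_card_diff real_pt_mem_regions
        p_def above_hpath_iff[OF h] below_hpath_iff[OF h])
  with inseparable_card_regions[OF P monotone_path_axioms] show ?thesis by simp
qed

lemma inseparable_bal_mirror_nonzero:
  assumes P: "inseparable_set n P" and h: "hpath h"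
  shows "bal (mirror_x ` P) h \<noteq> 0"
proof -
  \<comment> \<open>Reflection reverses the left-to-right order, hence the index
    \<open>- j\<close>.\<close>
  define p where "p j = (j + h (- j), h (- j))" for j
  interpret monotone_path "- 1" p
  proof
    fix j
    have "h (- j - 1) \<le> h (- j) \<and> h (- j) \<le> h (- j - 1) + 1"
      using h[unfolded hpath_def, rule_format, of "- j - 1"] by simp
    then have "h (- j) = h (- j - 1) \<or> h (- j) = h (- j - 1) + 1"
      by auto
    then show "p (j + 1) - p j \<in> {(1, 0), (0, - 1)}" by (auto simp: p_def)
  qed simp
  have "finite P" using P by (simp add: inseparable_set_def)
  have left: "real_pt q \<in> left_region (- 1) p \<longleftrightarrow> snd q < h (snd q - fst q)" for q
  proof -
    have "real_pt q \<in> left_region (- 1) p \<longleftrightarrow> (\<exists>j. - j - h (- j) < - fst q \<and> snd q < h (- j))"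
      unfolding real_pt_mem_regions by (auto simp: p_def algebra_simps)
    also have "\<dots> \<longleftrightarrow> (\<exists>i. i - h i < - fst q \<and> snd q < h i)" by (metis minus_minus)
    finally show ?thesis by (simp add: below_hpath_iff[OF h])
  qed
  have right: "real_pt q \<in> right_region (- 1) p \<longleftrightarrow> h (snd q - fst q) < snd q" for q
  proof -
    have "real_pt q \<in> right_region (- 1) p \<longleftrightarrow> (\<exists>j. - fst q < - j - h (- j) \<and> h (- j) < snd q)"
      unfolding real_pt_mem_regions by (auto simp: p_def algebra_simps)
    also have "\<dots> \<longleftrightarrow> (\<exists>i. - fst q < i - h i \<and> h i < snd q)" by (metis minus_minus)
    finally show ?thesis by (simp add: above_hpath_iff[OF h])
  qed
  \<comment> \<open>For a downhill path \<open>left_region\<close> is the lower left side, so the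
    positive signs belong to \<open>right_region\<close>.\<close>
  have "bal (mirror_x ` P) h =
      int (card {q \<in> P. real_pt q \<in> right_region (- 1) p}) - int (card {q \<in> P. real_pt q \<in> left_region (- 1) p})"
    using \<open>finite P\<close> by (simp add: bal_mirror_x sum_sgn_eq_card_diff left right)
  with inseparable_card_regions[OF P monotone_path_axioms] show ?thesis by simp
qed

section \<open>Balances of lines and existence of the quartering\<close>

lemma balance_hline:
  assumes "finite P"
  shows "balance P (hline K) = bal P (\<lambda>_. K)"
proof -
  interpret monotone_path 1 "hline K" by unfold_locales (simp_all add: hline_def)
  \<comment> \<open>The cell centres have abscissa 1/2, left of vertex 1 and right of vertex 0,
    which serve as the apexes.\<close>
  have "cell_left (hline K 0) (hline K 1) \<in> left_region 1 (hline K)"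
    by (auto simp: cell_left_def left_region_def hline_def real_pt_def midpoint_def scaleR_prod_def
        intro!: exI[of _ 1])
  then have l: "left_side (hline K) = left_region 1 (hline K)"
    unfolding left_side_def by (rule connected_component_region)
  have "cell_right (hline K 0) (hline K 1) \<in> right_region 1 (hline K)"
    by (auto simp: cell_right_def right_region_def hline_def real_pt_def midpoint_def scaleR_prod_def
        intro!: exI[of _ 0])
  then have r: "right_side (hline K) = right_region 1 (hline K)"
    unfolding right_side_def by (rule connected_component_region)
  have "real_pt q \<in> left_region 1 (hline K) \<longleftrightarrow> 0 < snd q - K"
    "real_pt q \<in> right_region 1 (hline K) \<longleftrightarrow> snd q - K < 0" for q
    unfolding real_pt_mem_regions by (auto simp: hline_def
        intro: exI[of _ "fst q + 1"] exI[of _ "fst q - 1"])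
  then show ?thesis
    using assms by (simp add: balance_def bal_def l r sum_sgn_eq_card_diff)
qed

lemma balance_vline:
  assumes "finite P"
  shows "balance P (vline K) = bal P (\<lambda>i. i - K)"
proof -
  interpret monotone_path 1 "vline K" by unfold_locales (simp_all add: vline_def)
  have "cell_left (vline K 0) (vline K 1) \<in> left_region 1 (vline K)"
    by (auto simp: cell_left_def left_region_def vline_def real_pt_def midpoint_def scaleR_prod_def
        intro!: exI[of _ 0])
  then have l: "left_side (vline K) = left_region 1 (vline K)"
    unfolding left_side_def by (rule connected_component_region)
  have "cell_right (vline K 0) (vline K 1) \<in> right_region 1 (vline K)"
    by (auto simp: cell_right_def right_region_def vline_def real_pt_def midpoint_def scaleR_prod_def
        intro!: exI[of _ 1])
  then have r: "right_side (vline K) = right_region 1 (vline K)"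
    unfolding right_side_def by (rule connected_component_region)
  have "real_pt q \<in> left_region 1 (vline K) \<longleftrightarrow> 0 < K - fst q"
    "real_pt q \<in> right_region 1 (vline K) \<longleftrightarrow> K - fst q < 0" for q
    unfolding real_pt_mem_regions by (auto simp: vline_def
        intro: exI[of _ "snd q - 1"] exI[of _ "snd q + 1"])
  then have "balance P (vline K) = (\<Sum>q\<in>P. sgn (K - fst q))"
    using assms by (simp add: balance_def l r sum_sgn_eq_card_diff)
  then show ?thesis by (simp add: bal_def algebra_simps)
qed

text \<open>\<open>m\<close> is the last argument with a positive value; since \<open>f\<close> has
  no zero, the next value is negative.\<close>

lemma ex1_sign_change:
  fixes f :: "int \<Rightarrow> int"
  assumes "antimono f" "\<And>k. f k \<noteq> 0" "f a > 0" "f b < 0"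
  shows "\<exists>!m. f (m + 1) < 0 \<and> f m > 0"
proof -
  have bound: "k \<le> b" if "f k > 0" for k
    using antimonoD[OF assms(1), of b k] that assms(4) by linarith
  have fin: "finite {k \<in> {a..b}. f k > 0}" by (rule finite_subset[of _ "{a..b}"]) auto
  define m where "m = Max {k \<in> {a..b}. f k > 0}"
  have "a \<in> {k \<in> {a..b}. f k > 0}" using assms(3) bound by simp
  then have m: "m \<in> {k \<in> {a..b}. f k > 0}" "\<And>k. k \<in> {k \<in> {a..b}. f k > 0} \<Longrightarrow> k \<le> m"
    unfolding m_def by (metis (no_types, lifting) Max_in empty_iff fin, metis (no_types, lifting) Max_ge fin)
  have "\<not> f (m + 1) > 0"
    using m(1) m(2)[of "m + 1"] bound[of "m + 1"] by auto
  with assms(2)[of "m + 1"] have m': "f (m + 1) < 0" by simp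
  show ?thesis
  proof (rule ex1I[of _ m])
    show "f (m + 1) < 0 \<and> 0 < f m" using m(1) m' by simp
    fix k
    assume k: "f (k + 1) < 0 \<and> 0 < f k"
    show "k = m"
    proof (rule ccontr)
      assume "k \<noteq> m"
      then consider "k + 1 \<le> m" | "m + 1 \<le> k" by linarith
      then show False
        using antimonoD[OF assms(1)] k m(1) m' by cases force+
    qed
  qed
qed

lemma quartered_inseparable:
  assumes "inseparable_set n P" "n \<ge> 1"
  shows "quartered P (quarter_M P) (quarter_T P)"
proof -
  have fin: "finite P" and "P \<noteq> {}" using assms by (auto simp: inseparable_set_def)
  \<comment> \<open>The lines at \<open>B\<close> and \<open>- B\<close> have all of
    \<open>P\<close> strictly on one side.\<close>
  define B where "B = (\<Sum>q\<in>P. \<bar>fst q\<bar> + \<bar>snd q\<bar>) + 1"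
  have B: "- B < fst q" "fst q < B" "- B < snd q" "snd q < B" if "q \<in> P" for q
    using member_le_sum[of q P "\<lambda>q. \<bar>fst q\<bar> + \<bar>snd q\<bar>"] that fin unfolding B_def by auto
  have card: "int (card P) > 0" using fin \<open>P \<noteq> {}\<close> by (simp add: card_gt_0_iff)
  have ext: "bal P (\<lambda>_. - B) = int (card P)" "bal P (\<lambda>_. B) = - int (card P)"
    "bal P (\<lambda>i. i - (- B)) = - int (card P)" "bal P (\<lambda>i. i - B) = int (card P)"
  proof -
    have "sgn (snd q - - B) = 1" "sgn (snd q - B) = - 1"
      "sgn (snd q - (fst q + snd q - - B)) = - 1" "sgn (snd q - (fst q + snd q - B)) = 1" if "q \<in> P" for q
      using B[OF that] by (simp_all add: sgn_if)
    then show "bal P (\<lambda>_. - B) = int (card P)" "bal P (\<lambda>_. B) = - int (card P)"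
      "bal P (\<lambda>i. i - (- B)) = - int (card P)" "bal P (\<lambda>i. i - B) = int (card P)"
      unfolding bal_def by simp_all
  qed
  have nz: "bal P h \<noteq> 0" if "hpath h" for h
    using inseparable_bal_nonzero[OF assms(1) that] .
  have "\<exists>!m. bal P (\<lambda>_. m + 1) < 0 \<and> bal P (\<lambda>_. m) > 0"
    by (rule ex1_sign_change[where f = "\<lambda>m. bal P (\<lambda>_. m)" and a = "- B" and b = B])
      (use card nz[OF hpath_const] in \<open>auto simp: ext intro!: antimonoI bal_antimono\<close>)
  from theI'[OF this] have M: "bal P (\<lambda>_. quarter_M P + 1) < 0" "bal P (\<lambda>_. quarter_M P) > 0"
    by (simp_all add: quarter_M_def balance_hline[OF fin])
  \<comment> \<open>Column balances increase to the right, hence the negation.\<close>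
  have "\<exists>!m. - bal P (\<lambda>i. i - (m + 1)) < 0 \<and> - bal P (\<lambda>i. i - m) > 0"
    by (rule ex1_sign_change[where f = "\<lambda>m. - bal P (\<lambda>i. i - m)" and a = "- B" and b = B])
      (use card nz[OF hpath_shift] in \<open>auto simp: ext simp del: diff_minus_eq_add intro!: antimonoI bal_antimono\<close>)
  then have "\<exists>!m. bal P (\<lambda>i. i - m) < 0 \<and> bal P (\<lambda>i. i - (m + 1)) > 0"
    by (simp add: conj_commute)
  from theI'[OF this] have T: "bal P (\<lambda>i. i - quarter_T P) < 0" "bal P (\<lambda>i. i - (quarter_T P + 1)) > 0"
    by (simp_all add: quarter_T_def balance_vline[OF fin])
  show ?thesis
    using fin nz inseparable_bal_mirror_nonzero[OF assms(1)] M T by unfold_locales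
qed

section \<open>The four quadrants and their integer diagonals\<close>

lemma quadrant_cases:
  assumes "r \<in> {1..4 :: nat}"
  obtains "r = 1" | "r = 2" | "r = 3" | "r = 4"
  using assms by fastforce

text \<open>Reflections carry each quadrant to the first one of a quartered set and keep local
  coordinates, so \<open>diagonal\<close> applies to all four.\<close>

lemma quadrant_diagonal:
  assumes "quartered P (quarter_M P) (quarter_T P)" "r \<in> {1..4}" "1 \<le> x" "1 \<le> y"
  shows "quadrant_point P r x y \<in> P \<longleftrightarrow> quadrant_point P r 1 (x + y - 1) \<in> P"
proof -
  define M T where "M = quarter_M P" and "T = quarter_T P"
  interpret Q1: quartered P M T using assms(1) by (simp add: M_def T_def)
  interpret Q2: quartered "mirror_x ` P" M "- T - 1" by (rule Q1.quartered_mirror_x)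
  interpret Q3: quartered "mirror_y ` mirror_x ` P" "- M - 1" "- T - 1" by (rule Q2.quartered_mirror_y)
  interpret Q4: quartered "mirror_y ` P" "- M - 1" T by (rule Q1.quartered_mirror_y)
  note eqs = Q1.diagonal[OF assms(3,4)] Q2.diagonal[OF assms(3,4)]
    Q3.diagonal[OF assms(3,4)] Q4.diagonal[OF assms(3,4)]
  from assms(2) show ?thesis
    by (cases rule: quadrant_cases)
      (use eqs in \<open>simp_all add: quadrant_point_def Let_def M_def[symmetric] T_def[symmetric] algebra_simps\<close>)
qed

lemma quadrant_nonempty:
  assumes "quartered P (quarter_M P) (quarter_T P)" "r \<in> {1..4}"
  shows "\<exists>x y. 1 \<le> x \<and> 1 \<le> y \<and> quadrant_point P r x y \<in> P"
proof -
  define M T where "M = quarter_M P" and "T = quarter_T P"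
  interpret Q1: quartered P M T using assms(1) by (simp add: M_def T_def)
  interpret Q2: quartered "mirror_x ` P" M "- T - 1" by (rule Q1.quartered_mirror_x)
  interpret Q3: quartered "mirror_y ` mirror_x ` P" "- M - 1" "- T - 1" by (rule Q2.quartered_mirror_y)
  interpret Q4: quartered "mirror_y ` P" "- M - 1" T by (rule Q1.quartered_mirror_y)
  note defs = quadrant_point_def Let_def M_def[symmetric] T_def[symmetric]
  from assms(2) show ?thesis
  proof (cases rule: quadrant_cases)
    case 1
    from Q1.Q1_nonempty obtain a b where "T < a" "M < b" "(a, b) \<in> P" by auto
    with 1 show ?thesis by (intro exI[of _ "a - T"] exI[of _ "b - M"]) (simp add: defs)
  next
    case 2
    from Q2.Q1_nonempty obtain a b where "- T - 1 < a" "M < b" "(- a, b) \<in> P" by auto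
    with 2 show ?thesis by (intro exI[of _ "a + T + 1"] exI[of _ "b - M"]) (simp add: defs)
  next
    case 3
    from Q3.Q1_nonempty obtain a b where "- T - 1 < a" "- M - 1 < b" "(- a, - b) \<in> P" by auto
    with 3 show ?thesis by (intro exI[of _ "a + T + 1"] exI[of _ "b + M + 1"]) (simp add: defs)
  next
    case 4
    from Q4.Q1_nonempty obtain a b where "T < a" "- M - 1 < b" "(a, - b) \<in> P" by auto
    with 4 show ?thesis by (intro exI[of _ "a - T"] exI[of _ "b + M + 1"]) (simp add: defs)
  qed
qed

lemma quadrant_point_inject:
  assumes "quadrant_point P r x y = quadrant_point P r' x' y'" "r \<in> {1..4}" "r' \<in> {1..4}"
    "1 \<le> x" "1 \<le> y" "1 \<le> x'" "1 \<le> y'"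
  shows "r = r' \<and> x = x' \<and> y = y'"
  using assms(2,3)
  by (elim quadrant_cases) (use assms in \<open>auto simp: quadrant_point_def Let_def\<close>)

lemma quadrant_point_surj:
  obtains r x y where "r \<in> {1..4}" "1 \<le> x" "1 \<le> y" "q = quadrant_point P r x y"
proof -
  obtain a b where q: "q = (a, b)" by (cases q)
  define u v where "u = a - quarter_T P" and "v = b - quarter_M P"
  have "q = quadrant_point P (if 0 < u then if 0 < v then 1 else 4 else if 0 < v then 2 else 3)
      (if 0 < u then u else 1 - u) (if 0 < v then v else 1 - v)"
    by (simp add: q quadrant_point_def Let_def u_def v_def)
  then show ?thesis by (rule that[rotated 3]) auto
qed

lemma int_diagonal_image:
  "int_diagonal P r k = (\<lambda>x. quadrant_point P r x (int k + 1 - x)) ` {1..int k}"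
  by (auto simp: int_diagonal_def)

lemma card_int_diagonal:
  assumes "r \<in> {1..4}"
  shows "card (int_diagonal P r k) = k"
proof -
  have "inj_on (\<lambda>x. quadrant_point P r x (int k + 1 - x)) {1..int k}"
    by (rule inj_onI) (use quadrant_point_inject[OF _ assms assms] in force)
  then show ?thesis by (simp add: int_diagonal_image card_image)
qed

lemma finite_int_diagonal: "finite (int_diagonal P r k)"
  by (simp add: int_diagonal_image)

lemma int_diagonal_disjoint:
  assumes "r \<in> {1..4}" "r' \<in> {1..4}" "(r, k) \<noteq> (r', k')"
  shows "int_diagonal P r k \<inter> int_diagonal P r' k' = {}"
proof (rule equals0I)
  fix q
  assume "q \<in> int_diagonal P r k \<inter> int_diagonal P r' k'"
  then obtain x x' where "1 \<le> x" "x \<le> int k" "1 \<le> x'" "x' \<le> int k'"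
    "quadrant_point P r x (int k + 1 - x) = quadrant_point P r' x' (int k' + 1 - x')"
    by (auto simp: int_diagonal_def)
  with quadrant_point_inject[OF this(5) assms(1,2)] assms(3) show False by simp
qed

lemma strict_mono_enumeration:
  fixes V :: "nat set"
  assumes "finite V"
  obtains v where "strict_mono_on {1..card V} v" "bij_betw v {1..card V} V"
proof -
  \<comment> \<open>The enumeration starts at 1, list positions at 0.\<close>
  define v where "v t = sorted_list_of_set V ! (t - 1)" for t
  have "strict_mono_on {1..card V} v"
    unfolding v_def
    by (intro strict_mono_onI sorted_wrt_nth_less[OF strict_sorted_list_of_set]) auto
  moreover have "v ` {1..card V} = V"
  proof -
    have "{1..card V} = Suc ` {..<card V}"
      by (simp add: lessThan_atLeast0 image_Suc_atLeastLessThan atLeastLessThanSuc_atLeastAtMost)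
    then have "v ` {1..card V} = (\<lambda>i. sorted_list_of_set V ! i) ` {..<length (sorted_list_of_set V)}"
      by (simp add: v_def image_image)
    also have "\<dots> = set (sorted_list_of_set V)" by (simp add: set_conv_nth image_def Bex_def conj_commute)
    finally show ?thesis using assms by simp
  qed
  ultimately show ?thesis
    using that[of v] by (simp add: bij_betw_def strict_mono_on_imp_inj_on)
qed

theorem proposition1:
  fixes P :: "(int \<times> int) set" and n :: nat
  assumes "n \<ge> 1"
    and "inseparable_set n P"
  shows "\<exists>(N :: nat \<Rightarrow> nat) (v :: nat \<Rightarrow> nat \<Rightarrow> nat).
           (\<forall>r\<in>{1..4}. N r \<ge> 1 \<and> v r 1 \<ge> 1 \<and> strict_mono_on {1..N r} (v r)) \<and>
           P = (\<Union>r\<in>{1..4}. \<Union>t\<in>{1..N r}. int_diagonal P r (v r t)) \<and>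
           n = (\<Sum>r=1..4. \<Sum>t=1..N r. v r t)"
proof -
  have fin: "finite P" and card: "card P = n" using assms(2) by (auto simp: inseparable_set_def)
  note Q = quartered_inseparable[OF assms(2,1)]
  \<comment> \<open>A diagonal is tested at its point with local coordinates (1, k). These points
    are distinct for distinct k, so \<open>V r\<close> is finite.\<close>
  define V where "V r = {k. 1 \<le> k \<and> quadrant_point P r 1 (int k) \<in> P}" for r
  have mem_iff: "quadrant_point P r x y \<in> P \<longleftrightarrow> nat (x + y - 1) \<in> V r"
    if "r \<in> {1..4}" "1 \<le> x" "1 \<le> y" for r x y
    using quadrant_diagonal[OF Q that] that by (auto simp: V_def)
  have finV: "finite (V r)" if r: "r \<in> {1..4}" for r
  proof (rule inj_on_finite[OF _ _ fin])
    show "inj_on (\<lambda>k. quadrant_point P r 1 (int k)) (V r)"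
      by (rule inj_onI) (use quadrant_point_inject[OF _ r r] in \<open>force simp: V_def\<close>)
  qed (auto simp: V_def)
  have neV: "V r \<noteq> {}" if "r \<in> {1..4}" for r
    using quadrant_nonempty[OF Q that] mem_iff[OF that] by blast
  have P_eq: "P = (\<Union>r\<in>{1..4}. \<Union>k\<in>V r. int_diagonal P r k)"
  proof (intro set_eqI iffI)
    fix q
    assume "q \<in> P"
    obtain r x y where q: "r \<in> {1..4}" "1 \<le> x" "1 \<le> y" "q = quadrant_point P r x y"
      by (rule quadrant_point_surj)
    with \<open>q \<in> P\<close> mem_iff have "nat (x + y - 1) \<in> V r" by blast
    moreover have "q \<in> int_diagonal P r (nat (x + y - 1))"
      using q by (auto simp: int_diagonal_def intro!: exI[of _ x])
    ultimately show "q \<in> (\<Union>r\<in>{1..4}. \<Union>k\<in>V r. int_diagonal P r k)" using q(1) by blast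
  next
    fix q
    assume "q \<in> (\<Union>r\<in>{1..4}. \<Union>k\<in>V r. int_diagonal P r k)"
    then obtain r k x where "r \<in> {1..4}" "k \<in> V r" "1 \<le> x" "x \<le> int k"
      "q = quadrant_point P r x (int k + 1 - x)"
      by (auto simp: int_diagonal_def)
    then show "q \<in> P" using mem_iff[of r x "int k + 1 - x"] by simp
  qed
  \<comment> \<open>Indexing by pairs makes this a single disjoint union, and diagonal
    \<open>k\<close> contributes \<open>k\<close> points.\<close>
  have "n = card (\<Union>(r, k)\<in>(SIGMA r:{1..4}. V r). int_diagonal P r k)"
    by (subst card[symmetric], subst P_eq) (auto intro!: arg_cong[of _ _ card])
  also have "\<dots> = (\<Sum>(r, k)\<in>(SIGMA r:{1..4}. V r). card (int_diagonal P r k))"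
    by (subst card_UN_disjoint)
      (use finV finite_int_diagonal int_diagonal_disjoint in \<open>auto simp: case_prod_beta\<close>)
  also have "\<dots> = (\<Sum>r=1..4. \<Sum>k\<in>V r. card (int_diagonal P r k))"
    using finV by (intro sum.Sigma[symmetric]) auto
  also have "\<dots> = (\<Sum>r=1..4. \<Sum>k\<in>V r. k)"
    by (intro sum.cong refl card_int_diagonal)
  finally have n_eq: "n = (\<Sum>r=1..4. \<Sum>k\<in>V r. k)" .
  have "\<forall>r. \<exists>v. r \<in> {1..4} \<longrightarrow> strict_mono_on {1..card (V r)} v \<and> bij_betw v {1..card (V r)} (V r)"
    using finV strict_mono_enumeration by metis
  then obtain v where v: "\<And>r. r \<in> {1..4} \<Longrightarrow> strict_mono_on {1..card (V r)} (v r)"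
    "\<And>r. r \<in> {1..4} \<Longrightarrow> bij_betw (v r) {1..card (V r)} (V r)"
    by metis
  show ?thesis
  proof (rule exI[of _ "\<lambda>r. card (V r)"], rule exI[of _ v], intro conjI ballI)
    fix r :: nat
    assume r: "r \<in> {1..4}"
    show N: "1 \<le> card (V r)" using finV[OF r] neV[OF r] by (simp add: Suc_le_eq card_gt_0_iff)
    show "strict_mono_on {1..card (V r)} (v r)" using v(1)[OF r] .
    have "v r 1 \<in> V r" using bij_betwE[OF v(2)[OF r]] N by auto
    then show "1 \<le> v r 1" by (simp add: V_def)
  next
    have "(\<Union>t\<in>{1..card (V r)}. int_diagonal P r (v r t)) = (\<Union>k\<in>V r. int_diagonal P r k)"
      if "r \<in> {1..4}" for r
      using bij_betw_imp_surj_on[OF v(2)[OF that]] by (metis image_image)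
    then show "P = (\<Union>r\<in>{1..4}. \<Union>t\<in>{1..card (V r)}. int_diagonal P r (v r t))"
      using P_eq by simp
  next
    have "(\<Sum>t=1..card (V r). v r t) = (\<Sum>k\<in>V r. k)" if "r \<in> {1..4}" for r
      using sum.reindex_bij_betw[OF v(2)[OF that], of "\<lambda>k. k"] .
    then show "n = (\<Sum>r=1..4. \<Sum>t=1..card (V r). v r t)"
      using n_eq by simp
  qed
qed

end
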